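(* Let $m \geq 0$ and $s \in \{0,1,2,3\}$ be integers. Define the closed line segments $\ell_1$ joining $(0,1)$ and $(m-\tfrac12, m+\tfrac12)$; $\ell_2$ joining $(1,0)$ and $(m+\tfrac12, m-\tfrac12)$; $\ell_3$ joining $(m-1, m+1)$ and $(m+s-1, m+s+1)$; $\ell_4$ joining $(m+1, m-1)$ and $(m+s+1, m+s-1)$. Then $S(m, m+s) = \frac{(2m)!\,(2m+2s)!}{m!\,(m+s)!\,(2m+s)!}$ equals the number of lattice paths from $(0,0)$ to $(m+s, m+s)$ with unit right and up steps that pass through $(m,m)$ and that neither intersect both $\ell_1$ and $\ell_4$, nor intersect both $\ell_2$ and $\ell_3$.
   Context: A lattice path uses unit steps $(1,0)$ (right) and $(0,1)$ (up); it is regarded as the polygonal curve through its lattice points, and "intersects" a segment means this curve and the segment have a common point. The super Catalan number is $S(m,n)=\frac{(2m)!(2n)!}{m!\,n!\,(m+n)!}$.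
   Formalization: The pair m = 0, s = 3 is excluded: there ℓ1 contains (0,1) and ℓ4 contains (3,1), so the path URRRUU and its mirror image are ruled out, leaving 18 paths while S(0,3) = 20. *)

theory Defs
  imports "HOL-Analysis.Analysis"
begin

definition super_catalan :: "nat \<Rightarrow> nat \<Rightarrow> real" where
  "super_catalan m n = (fact (2 * m) * fact (2 * n)) / (fact m * fact n * fact (m + n))"

definition unit_step :: "int \<times> int \<Rightarrow> int \<times> int \<Rightarrow> bool" where
  "unit_step p q \<longleftrightarrow> q = p + (1, 0) \<or> q = p + (0, 1)"

text \<open>A lattice path is the nonempty list of the lattice points it visits, in order.\<close>

definition lattice_paths :: "int \<times> int \<Rightarrow> int \<times> int \<Rightarrow> (int \<times> int) list set" where
  "lattice_paths p q =
    {ps. ps \<noteq> [] \<and> successively unit_step ps \<and> hd ps = p \<and> last ps = q}"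

definition plane_point :: "int \<times> int \<Rightarrow> real \<times> real" where
  "plane_point p = (of_int (fst p), of_int (snd p))"

fun path_curve :: "(int \<times> int) list \<Rightarrow> (real \<times> real) set" where
  "path_curve [] = {}"
| "path_curve [p] = {plane_point p}"
| "path_curve (p # q # ps) =
    closed_segment (plane_point p) (plane_point q) \<union> path_curve (q # ps)"

definition intersects :: "(int \<times> int) list \<Rightarrow> (real \<times> real) set \<Rightarrow> bool" where
  "intersects ps l \<longleftrightarrow> path_curve ps \<inter> l \<noteq> {}"

definition seg1 :: "nat \<Rightarrow> (real \<times> real) set" where
  "seg1 m = closed_segment (0, 1) (real m - 1/2, real m + 1/2)"

definition seg2 :: "nat \<Rightarrow> (real \<times> real) set" where
  "seg2 m = closed_segment (1, 0) (real m + 1/2, real m - 1/2)"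

definition seg3 :: "nat \<Rightarrow> nat \<Rightarrow> (real \<times> real) set" where
  "seg3 m s = closed_segment (real m - 1, real m + 1)
     (real m + real s - 1, real m + real s + 1)"

definition seg4 :: "nat \<Rightarrow> nat \<Rightarrow> (real \<times> real) set" where
  "seg4 m s = closed_segment (real m + 1, real m - 1)
     (real m + real s + 1, real m + real s - 1)"

text \<open>
  For \<open>m = 0\<close> the segment \<open>seg1 0\<close> still contains the lattice point \<open>(0, 1)\<close>, and
  \<open>seg2 0\<close> contains \<open>(1, 0)\<close>. Hence for \<open>m = 0\<close>, \<open>s = 3\<close> the path through
  \<open>(0,0), (0,1), (1,1), (2,1), (3,1), (3,2), (3,3)\<close> meets both \<open>seg1 0\<close> and \<open>seg4 0 3\<close>,
  and its mirror image meets both \<open>seg2 0\<close> and \<open>seg3 0 3\<close>. Only 18 of the 20 paths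
  remain, whereas \<open>super_catalan 0 3 = 20\<close>. This is why the pair \<open>m = 0\<close>, \<open>s = 3\<close> has to
  be left out when counting \<open>admissible_paths\<close>.
\<close>

definition admissible_paths :: "nat \<Rightarrow> nat \<Rightarrow> (int \<times> int) list set" where
  "admissible_paths m s =
    {ps \<in> lattice_paths (0, 0) (int (m + s), int (m + s)).
       (int m, int m) \<in> set ps \<and>
       \<not> (intersects ps (seg1 m) \<and> intersects ps (seg4 m s)) \<and>
       \<not> (intersects ps (seg2 m) \<and> intersects ps (seg3 m s))}"

end

theory Submission
  imports Defs
begin

text \<open>
  Split an admissible path at \<open>(m, m)\<close> into halves \<open>h\<close> and \<open>k\<close>. For \<open>m > 0\<close>, the path meets \<open>seg1\<close>
  or \<open>seg2\<close> iff \<open>h\<close> goes strictly above or below the diagonal, and it meets \<open>seg3\<close> or \<open>seg4\<close>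
  iff \<open>k\<close> moves at least two units above or below it. As \<open>s \<le> 3\<close>, no \<open>k\<close> does both, so the two
  forbidden events are disjoint and the count is
  \<open>B * (2s choose s) - 2 * (B - C) * N\<close> with \<open>B = (2m choose m)\<close>, the Catalan number \<open>C = B / (m + 1)\<close>
  counting the \<open>h\<close> on one side of the diagonal, and \<open>N\<close> the number of \<open>k\<close> that move two units above
  the diagonal, which is \<open>0, 0, 1, 6\<close> for \<open>s = 0, 1, 2, 3\<close>. For \<open>m = 0\<close> and \<open>s \<le> 2\<close> every path is
  admissible.
\<close>

section \<open>Lattice paths as chains of lattice points\<close>

text \<open>The points of a path form a chain in this order. It confines a path to the rectangle
  spanned by its ends and rules out two incomparable points on one path.\<close>

definition dominated :: "int \<times> int \<Rightarrow> int \<times> int \<Rightarrow> bool" where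
  "dominated p q \<longleftrightarrow> fst p \<le> fst q \<and> snd p \<le> snd q"

lemma unit_step_cases:
  assumes "unit_step p q"
  obtains "fst q = fst p + 1" "snd q = snd p" | "fst q = fst p" "snd q = snd p + 1"
  using assms by (auto simp: unit_step_def)

lemma path_sorted:
  assumes "successively unit_step ps"
  shows "sorted_wrt dominated ps"
proof -
  have "successively dominated ps"
    using assms by (rule successively_mono) (auto simp: unit_step_def dominated_def)
  moreover have "transp dominated"
    by (auto simp: transp_def dominated_def)
  ultimately show ?thesis
    by (simp add: successively_conv_sorted_wrt)
qed

lemma path_comparable:
  assumes "successively unit_step ps" "x \<in> set ps" "y \<in> set ps"
  shows "dominated x y \<or> dominated y x"
proof -
  obtain i j where ij: "i < length ps" "j < length ps" "x = ps ! i" "y = ps ! j"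
    using assms by (metis in_set_conv_nth)
  have "i < j \<or> j < i \<or> i = j"
    by linarith
  with ij path_sorted[OF assms(1)] show ?thesis
    by (auto simp: sorted_wrt_iff_nth_less dominated_def)
qed

lemma path_between:
  assumes "ps \<in> lattice_paths p q" "x \<in> set ps"
  shows "dominated p x" "dominated x q"
proof -
  have ps: "ps \<noteq> []" "sorted_wrt dominated ps" "hd ps = p" "last ps = q"
    using assms(1) by (auto simp: lattice_paths_def intro: path_sorted)
  show "dominated p x"
    using ps assms(2) by (cases ps) (auto simp: dominated_def)
  obtain qs where "ps = qs @ [q]"
    using ps(1,4) by (metis append_butlast_last_id)
  then have "sorted_wrt dominated (qs @ [q])" "x \<in> set qs \<or> x = q"
    using ps(2) assms(2) by auto
  then show "dominated x q"
    by (auto simp: sorted_wrt_append dominated_def)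
qed

text \<open>Each step raises the coordinate sum by one. The length thus depends only on the end
  points, which makes the splitting of a path at a given point unique.\<close>

lemma path_length:
  assumes "ps \<in> lattice_paths p q"
  shows "int (length ps) = fst q - fst p + snd q - snd p + 1"
proof -
  have "int (length ps) = fst (last ps) - fst (hd ps) + snd (last ps) - snd (hd ps) + 1"
    if "ps \<noteq> []" "successively unit_step ps"
    using that
  proof (induction ps rule: induct_list012)
    case (3 x y zs)
    then show ?case
      by (auto simp: unit_step_def)
  qed auto
  with assms show ?thesis
    by (auto simp: lattice_paths_def)
qed

section \<open>Counting paths inside a region by their last step\<close>

lemma lattice_paths_snoc:
  "lattice_paths p q = (if p = q then {[q]} else {}) \<union>
    (\<lambda>ps. ps @ [q]) ` (lattice_paths p (q - (1, 0)) \<union> lattice_paths p (q - (0, 1)))"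
    (is "?L = ?R")
proof
  show "?L \<subseteq> ?R"
  proof
    fix ps assume ps: "ps \<in> ?L"
    then have eq: "ps = butlast ps @ [q]"
      by (auto simp: lattice_paths_def)
    show "ps \<in> ?R"
    proof (cases "butlast ps = []")
      case True
      with ps eq have "ps = [q]"
        by simp
      with ps show ?thesis
        by (auto simp: lattice_paths_def)
    next
      case False
      from ps have "successively unit_step (butlast ps @ [q])" "hd (butlast ps @ [q]) = p"
        using eq by (auto simp: lattice_paths_def)
      with False have "successively unit_step (butlast ps)" "unit_step (last (butlast ps)) q"
          "hd (butlast ps) = p"
        by (auto simp: successively_append_iff)
      with False have "butlast ps \<in> lattice_paths p (q - (1, 0)) \<union> lattice_paths p (q - (0, 1))"
        by (auto simp: lattice_paths_def unit_step_def)
      with eq show ?thesis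
        by blast
    qed
  qed
  show "?R \<subseteq> ?L"
    by (auto simp: lattice_paths_def successively_append_iff unit_step_def)
qed

definition paths_within :: "(int \<times> int \<Rightarrow> bool) \<Rightarrow> int \<times> int \<Rightarrow> int \<times> int \<Rightarrow> (int \<times> int) list set"
  where "paths_within P p q = {ps \<in> lattice_paths p q. \<forall>x\<in>set ps. P x}"

lemma paths_within_True: "paths_within (\<lambda>_. True) p q = lattice_paths p q"
  by (simp add: paths_within_def)

lemma paths_within_snoc:
  "paths_within P p q = (if P q then (if p = q then {[q]} else {}) \<union>
    (\<lambda>ps. ps @ [q]) ` (paths_within P p (q - (1, 0)) \<union> paths_within P p (q - (0, 1))) else {})"
  unfolding paths_within_def
  by (subst lattice_paths_snoc) auto

text \<open>Disposes of the predecessors of \<open>q\<close> that lie to the left of or below the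
  start, which the last-step recursion produces on the boundary of the quadrant.\<close>

lemma paths_within_not_dominated:
  assumes "\<not> dominated p q"
  shows "paths_within P p q = {}"
proof -
  have "dominated p q" if "ps \<in> lattice_paths p q" for ps
  proof -
    from that have "last ps \<in> set ps" "last ps = q"
      by (auto simp: lattice_paths_def)
    with path_between(1)[OF that] show ?thesis
      by blast
  qed
  with assms show ?thesis
    by (auto simp: paths_within_def)
qed

text \<open>Pascal's recurrence cut off outside \<open>Q\<close>, in coordinates relative to the
  start. Unlike the set of paths, it can be evaluated by rewriting for concrete arguments.\<close>

fun path_count :: "(nat \<Rightarrow> nat \<Rightarrow> bool) \<Rightarrow> nat \<Rightarrow> nat \<Rightarrow> nat" where
  "path_count Q 0 0 = (if Q 0 0 then 1 else 0)"
| "path_count Q (Suc i) 0 = (if Q (Suc i) 0 then path_count Q i 0 else 0)"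
| "path_count Q 0 (Suc j) = (if Q 0 (Suc j) then path_count Q 0 j else 0)"
| "path_count Q (Suc i) (Suc j) =
    (if Q (Suc i) (Suc j) then path_count Q i (Suc j) + path_count Q (Suc i) j else 0)"

lemma path_count_swap: "path_count (\<lambda>i j. Q j i) i j = path_count Q j i"
  by (induction Q j i rule: path_count.induct) auto

lemma path_count_all: "path_count (\<lambda>_ _. True) i j = (i + j) choose i"
  by (induction "\<lambda>(_ :: nat) (_ :: nat). True" i j rule: path_count.induct) (auto simp: add.commute)

text \<open>Removing the last point of a path mirrors the recursion of \<open>path_count\<close>.
  Finiteness is carried along because adding the two cardinalities needs it.\<close>

lemma card_paths_within:
  "finite (paths_within P (a, b) (a + int i, b + int j)) \<and>
   card (paths_within P (a, b) (a + int i, b + int j)) =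
     path_count (\<lambda>i j. P (a + int i, b + int j)) i j"
proof (induction "\<lambda>i j. P (a + int i, b + int j)" i j rule: path_count.induct)
  case 1
  show ?case
    by (subst (1 2) paths_within_snoc) (auto simp: paths_within_not_dominated dominated_def)
next
  case (2 i)
  have 0: "paths_within P (a, b) (a + int (Suc i), b + int 0) = (if P (a + int (Suc i), b + int 0)
    then (\<lambda>ps. ps @ [(a + int (Suc i), b + int 0)]) ` paths_within P (a, b) (a + int i, b + int 0)
    else {})"
    by (subst paths_within_snoc) (auto simp: paths_within_not_dominated dominated_def)
  show ?case
    unfolding 0 using 2 by (auto simp: card_image inj_on_def)
next
  case (3 j)
  have 0: "paths_within P (a, b) (a + int 0, b + int (Suc j)) = (if P (a + int 0, b + int (Suc j))
    then (\<lambda>ps. ps @ [(a + int 0, b + int (Suc j))]) ` paths_within P (a, b) (a + int 0, b + int j)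
    else {})"
    by (subst paths_within_snoc) (auto simp: paths_within_not_dominated dominated_def)
  show ?case
    unfolding 0 using 3 by (auto simp: card_image inj_on_def)
next
  case (4 i j)
  let ?q = "(a + int (Suc i), b + int (Suc j))"
  let ?X = "paths_within P (a, b) (a + int i, b + int (Suc j))"
  let ?Y = "paths_within P (a, b) (a + int (Suc i), b + int j)"
  have 0: "paths_within P (a, b) ?q = (if P ?q then (\<lambda>ps. ps @ [?q]) ` (?X \<union> ?Y) else {})"
    by (subst paths_within_snoc) (auto simp: algebra_simps)
  \<comment> \<open>The two families have different last points.\<close>
  have "?X \<inter> ?Y = {}"
    by (auto simp: paths_within_def lattice_paths_def)
  moreover have "card ((\<lambda>ps. ps @ [?q]) ` (?X \<union> ?Y)) = card (?X \<union> ?Y)"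
    by (intro card_image) (auto simp: inj_on_def)
  ultimately show ?case
    unfolding 0 using 4 by (auto simp: card_Un_disjoint)
qed

section \<open>Ballot and Catalan numbers\<close>

text \<open>The ballot formula, stated additively to avoid truncated subtraction. Both sides obey
  Pascal's recurrence. The line \<open>j = Suc i\<close> just outside the region is included so that
  the induction hypothesis covers both predecessors of a diagonal point.\<close>

lemma path_count_ballot:
  "j \<le> Suc i \<Longrightarrow> path_count (\<lambda>i j. j \<le> i) i j + (if j = 0 then 0 else (i + j) choose (j - 1))
     = (i + j) choose j"
proof (induction "\<lambda>i j :: nat. j \<le> i" i j rule: path_count.induct)
  case (4 i j)
  show ?case
  proof (cases "j \<le> i")
    case True
    then show ?thesis
      using 4 by (cases j) auto
  next
    case False
    with 4 have j: "j = Suc i"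
      by simp
    \<comment> \<open>On the line above the diagonal \<open>path_count\<close> vanishes, and the two
      binomial coefficients agree by symmetry.\<close>
    have "(Suc i + Suc (Suc i)) choose Suc i = (Suc i + Suc (Suc i)) choose Suc (Suc i)"
      by (subst binomial_symmetric) auto
    then show ?thesis
      by (simp add: j)
  qed
qed auto

lemma path_count_catalan:
  "(m + 1) * path_count (\<lambda>i j. j \<le> i) m m = (2 * m) choose m"
proof (cases m)
  case (Suc n)
  \<comment> \<open>Both sides equal \<open>2 * m * ((2 * m - 1) choose n)\<close>.\<close>
  have "m * ((2 * m) choose m) = (m + 1) * ((2 * m) choose (m - 1))"
    using binomial_absorb_comp[of "2 * m" n] binomial_absorption[of n "2 * m"]
    by (simp add: Suc)
  moreover have "path_count (\<lambda>i j. j \<le> i) m m + ((2 * m) choose (m - 1)) = (2 * m) choose m"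
    using path_count_ballot[of m m] by (simp add: Suc mult_2)
  then have "(m + 1) * path_count (\<lambda>i j. j \<le> i) m m + (m + 1) * ((2 * m) choose (m - 1)) =
      (m + 1) * ((2 * m) choose m)"
    by (metis add_mult_distrib2)
  ultimately show ?thesis
    by simp
qed auto

section \<open>Where a path meets an integer diagonal\<close>

text \<open>A discrete intermediate value theorem: since \<open>f\<close> rises by at most one per
  step, it cannot jump over \<open>c\<close>.\<close>

lemma path_visits_level:
  fixes f :: "int \<times> int \<Rightarrow> int"
  assumes "successively unit_step ps" "ps \<noteq> []"
    and "\<And>p q. unit_step p q \<Longrightarrow> f q \<le> f p + 1"
    and "f (hd ps) \<le> c" "x \<in> set ps" "c \<le> f x"
  shows "\<exists>y\<in>set ps. f y = c"
  using assms
proof (induction ps rule: induct_list012)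
  case (3 p q ps)
  show ?case
  proof (cases "f p = c")
    case False
    have "f q \<le> f p + 1"
      using "3.prems"(1) by (intro "3.prems"(3)) simp
    with False "3.prems"(4-6) have q: "f (hd (q # ps)) \<le> c" "x \<in> set (q # ps)"
      by auto
    have "\<exists>y\<in>set (q # ps). f y = c"
      using "3.prems" by (intro "3.IH"(2) q) auto
    then show ?thesis
      by auto
  qed auto
qed auto

text \<open>\<open>min\<close> and \<open>max\<close> leave the order of the end points open,
  because \<open>seg1\<close> and \<open>seg2\<close> run backwards when
  \<open>m = 0\<close>.\<close>

lemma mem_diagonal_segment_iff:
  fixes a b c u v :: real
  shows "(a, b) \<in> closed_segment (u, u + c) (v, v + c) \<longleftrightarrow>
    b = a + c \<and> min u v \<le> a \<and> a \<le> max u v"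
proof -
  have "(a, b) \<in> closed_segment (u, u + c) (v, v + c) \<longleftrightarrow> b = a + c \<and> a \<in> closed_segment u v"
    by (auto simp: closed_segment_def algebra_simps)
  also have "\<dots> \<longleftrightarrow> b = a + c \<and> min u v \<le> a \<and> a \<le> max u v"
    by (auto simp: closed_segment_eq_real_ivl)
  finally show ?thesis .
qed

text \<open>Along a unit step the difference of the coordinates changes by one, hence it takes
  integer values only at the two end points.\<close>

lemma unit_step_meets_diagonal:
  assumes "unit_step p q" "z \<in> closed_segment (plane_point p) (plane_point q)"
    and "snd z - fst z = of_int c"
  shows "z = plane_point p \<or> z = plane_point q"
proof -
  obtain t where t: "0 \<le> t" "t \<le> 1" "z = (1 - t) *\<^sub>R plane_point p + t *\<^sub>R plane_point q"
    using assms(2) by (auto simp: closed_segment_def)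
  obtain d where "t = of_int d"
    using assms(1)
  proof (cases rule: unit_step_cases)
    case 1
    then have "t = of_int (snd p - fst p - c)"
      using assms(3) t(3) by (simp add: plane_point_def algebra_simps)
    then show ?thesis using that by blast
  next
    case 2
    then have "t = of_int (c - snd p + fst p)"
      using assms(3) t(3) by (simp add: plane_point_def algebra_simps)
    then show ?thesis using that by blast
  qed
  moreover from this t have "d = 0 \<or> d = 1"
    by auto
  ultimately show ?thesis
    using t(3) by auto
qed

lemma plane_point_in_path_curve: "x \<in> set ps \<Longrightarrow> plane_point x \<in> path_curve ps"
  by (induction ps rule: path_curve.induct) auto

text \<open>The polygonal curve can meet an integer diagonal only at its vertices, so from here on
  only lattice points matter.\<close>

lemma intersects_diagonal_iff:
  assumes "successively unit_step ps" "\<And>z. z \<in> L \<Longrightarrow> snd z - fst z = of_int c"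
  shows "intersects ps L \<longleftrightarrow> (\<exists>x\<in>set ps. plane_point x \<in> L)"
proof -
  have "\<exists>x\<in>set ps. z = plane_point x" if "z \<in> path_curve ps" "z \<in> L" for z
    using that assms(1)
  proof (induction ps rule: path_curve.induct)
    case (3 p q ps)
    then show ?case
      using unit_step_meets_diagonal[of p q z c] assms(2) by auto
  qed auto
  then show ?thesis
    using plane_point_in_path_curve by (force simp: intersects_def)
qed

lemma intersects_segment_iff:
  fixes c :: int
  assumes "successively unit_step ps"
  shows "intersects ps (closed_segment (u, u + of_int c) (v, v + of_int c)) \<longleftrightarrow>
    (\<exists>(x, y)\<in>set ps. y = x + c \<and> min u v \<le> of_int x \<and> of_int x \<le> max u v)"
proof -
  have *: "intersects ps (closed_segment (u, u + of_int c) (v, v + of_int c)) \<longleftrightarrow>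
    (\<exists>x\<in>set ps. plane_point x \<in> closed_segment (u, u + of_int c) (v, v + of_int c))"
    by (rule intersects_diagonal_iff[OF assms]) (auto simp: mem_diagonal_segment_iff)
  have "real_of_int y = of_int x + of_int c \<longleftrightarrow> y = x + c" for x y
    by linarith
  then show ?thesis
    unfolding * by (auto simp: plane_point_def mem_diagonal_segment_iff split_def)
qed

text \<open>For \<open>m > 0\<close> the half-integral end point cuts off at \<open>x < m\<close>.
  For \<open>m = 0\<close> the segment extends to the left of \<open>(0, 1)\<close> and this end
  point is its only lattice point, whence the extra disjunct.\<close>

lemma intersects_seg1_iff:
  assumes "successively unit_step ps"
  shows "intersects ps (seg1 m) \<longleftrightarrow>
    (\<exists>(x, y)\<in>set ps. y = x + 1 \<and> (0 \<le> x \<and> x < int m \<or> m = 0 \<and> x = 0))"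
proof -
  have "seg1 m = closed_segment (0, 0 + of_int 1) (real m - 1/2, real m - 1/2 + of_int 1)"
    by (simp add: seg1_def add.commute)
  then have "intersects ps (seg1 m) \<longleftrightarrow> (\<exists>(x, y)\<in>set ps. y = x + 1 \<and>
      min 0 (real m - 1/2) \<le> of_int x \<and> of_int x \<le> max 0 (real m - 1/2))"
    by (simp only: intersects_segment_iff[OF assms])
  moreover have "min 0 (real m - 1/2) \<le> of_int x \<and> of_int x \<le> max 0 (real m - 1/2) \<longleftrightarrow>
      0 \<le> x \<and> x < int m \<or> m = 0 \<and> x = 0" for x
    by linarith
  ultimately show ?thesis
    by simp
qed

lemma intersects_seg2_iff:
  assumes "successively unit_step ps"
  shows "intersects ps (seg2 m) \<longleftrightarrow>
    (\<exists>(x, y)\<in>set ps. x = y + 1 \<and> (0 \<le> y \<and> y < int m \<or> m = 0 \<and> y = 0))"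
proof -
  have "seg2 m = closed_segment (1, 1 + of_int (-1)) (real m + 1/2, real m + 1/2 + of_int (-1))"
    by (simp add: seg2_def)
  then have "intersects ps (seg2 m) \<longleftrightarrow> (\<exists>(x, y)\<in>set ps. y = x + (-1) \<and>
      min 1 (real m + 1/2) \<le> of_int x \<and> of_int x \<le> max 1 (real m + 1/2))"
    by (simp only: intersects_segment_iff[OF assms])
  moreover have "y = x + (-1) \<and> min 1 (real m + 1/2) \<le> of_int x \<and> of_int x \<le> max 1 (real m + 1/2)
      \<longleftrightarrow> x = y + 1 \<and> (0 \<le> y \<and> y < int m \<or> m = 0 \<and> y = 0)" for x y
    by linarith
  ultimately show ?thesis
    by (simp only:)
qed

lemma intersects_seg3_iff:
  assumes "successively unit_step ps"
  shows "intersects ps (seg3 m s) \<longleftrightarrow>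
    (\<exists>(x, y)\<in>set ps. y = x + 2 \<and> int m - 1 \<le> x \<and> x \<le> int m + int s - 1)"
proof -
  have "seg3 m s = closed_segment (real m - 1, real m - 1 + of_int 2)
      (real m + real s - 1, real m + real s - 1 + of_int 2)"
    by (simp add: seg3_def add.commute)
  then have "intersects ps (seg3 m s) \<longleftrightarrow> (\<exists>(x, y)\<in>set ps. y = x + 2 \<and>
      min (real m - 1) (real m + real s - 1) \<le> of_int x \<and>
      of_int x \<le> max (real m - 1) (real m + real s - 1))"
    by (simp only: intersects_segment_iff[OF assms])
  moreover have "min (real m - 1) (real m + real s - 1) \<le> of_int x \<and>
      of_int x \<le> max (real m - 1) (real m + real s - 1) \<longleftrightarrow>
      int m - 1 \<le> x \<and> x \<le> int m + int s - 1" for x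
    by linarith
  ultimately show ?thesis
    by (simp only:)
qed

lemma intersects_seg4_iff:
  assumes "successively unit_step ps"
  shows "intersects ps (seg4 m s) \<longleftrightarrow>
    (\<exists>(x, y)\<in>set ps. x = y + 2 \<and> int m - 1 \<le> y \<and> y \<le> int m + int s - 1)"
proof -
  have "seg4 m s = closed_segment (real m + 1, real m + 1 + of_int (-2))
      (real m + real s + 1, real m + real s + 1 + of_int (-2))"
    by (simp add: seg4_def)
  then have "intersects ps (seg4 m s) \<longleftrightarrow> (\<exists>(x, y)\<in>set ps. y = x + (-2) \<and>
      min (real m + 1) (real m + real s + 1) \<le> of_int x \<and>
      of_int x \<le> max (real m + 1) (real m + real s + 1))"
    by (simp only: intersects_segment_iff[OF assms])
  moreover have "y = x + (-2) \<and> min (real m + 1) (real m + real s + 1) \<le> of_int x \<and>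
      of_int x \<le> max (real m + 1) (real m + real s + 1) \<longleftrightarrow>
      x = y + 2 \<and> int m - 1 \<le> y \<and> y \<le> int m + int s - 1" for x y
    by linarith
  ultimately show ?thesis
    by (simp only:)
qed

section \<open>Splitting a path at a point\<close>

text \<open>The point \<open>c\<close> ends \<open>h\<close> and begins \<open>k\<close>;
  \<open>tl\<close> drops the repeated copy.\<close>

lemma lattice_paths_through:
  "{ps \<in> lattice_paths p q. c \<in> set ps} =
    (\<lambda>(h, k). h @ tl k) ` (lattice_paths p c \<times> lattice_paths c q)" (is "?L = ?R")
proof
  show "?L \<subseteq> ?R"
  proof
    fix ps assume "ps \<in> ?L"
    then obtain as bs where ps: "ps = as @ c # bs" "ps \<in> lattice_paths p q"
      by (auto dest: split_list)
    then have "as @ [c] \<in> lattice_paths p c" "c # bs \<in> lattice_paths c q"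
      by (auto simp: lattice_paths_def successively_append_iff successively_Cons hd_append
          split: if_splits)
    with ps(1) show "ps \<in> ?R"
      by (intro image_eqI[of _ _ "(as @ [c], c # bs)"]) auto
  qed
  show "?R \<subseteq> ?L"
  proof clarify
    fix h k assume hk: "h \<in> lattice_paths p c" "k \<in> lattice_paths c q"
    then obtain bs where k: "k = c # bs"
      by (cases k) (auto simp: lattice_paths_def)
    from hk have h: "h = butlast h @ [c]"
      by (auto simp: lattice_paths_def)
    from hk(1) have "c \<in> set h"
      by (auto simp: lattice_paths_def)
    with hk h k show "h @ tl k \<in> lattice_paths p q \<and> c \<in> set (h @ tl k)"
      by (auto simp: lattice_paths_def successively_append_iff successively_Cons hd_append)
  qed
qed

text \<open>All first halves have the same length, so equal joins are cut at the same place;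
  \<open>tl k\<close> determines \<open>k\<close> since its head is \<open>c\<close>.\<close>

lemma inj_on_join_paths:
  "inj_on (\<lambda>(h, k). h @ tl k) (lattice_paths p c \<times> lattice_paths c q)"
proof (rule inj_onI, clarify)
  fix h k h' k'
  assume *: "h \<in> lattice_paths p c" "k \<in> lattice_paths c q"
    "h' \<in> lattice_paths p c" "k' \<in> lattice_paths c q" "h @ tl k = h' @ tl k'"
  have "length h = length h'"
    using path_length[OF *(1)] path_length[OF *(3)] by simp
  with *(5) have "h = h'" "tl k = tl k'"
    by auto
  moreover have "k = c # tl k" "k' = c # tl k'"
    using *(2,4) by (cases k; cases k'; simp add: lattice_paths_def)+
  ultimately show "h = h' \<and> k = k'"
    by metis
qed

section \<open>Paths that reach a line parallel to the diagonal\<close>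

lemma card_lattice_paths:
  "finite (lattice_paths (a, b) (a + int i, b + int j))"
  "card (lattice_paths (a, b) (a + int i, b + int j)) = (i + j) choose i"
  using card_paths_within[of "\<lambda>_. True" a b i j] by (simp_all add: paths_within_True path_count_all)

lemma card_paths_leaving:
  "card {ps \<in> lattice_paths (a, b) (a + int i, b + int j). \<exists>x\<in>set ps. \<not> P x} =
    ((i + j) choose i) - path_count (\<lambda>i j. P (a + int i, b + int j)) i j"
proof -
  let ?L = "lattice_paths (a, b) (a + int i, b + int j)"
  let ?W = "paths_within P (a, b) (a + int i, b + int j)"
  have "{ps \<in> ?L. \<exists>x\<in>set ps. \<not> P x} = ?L - ?W"
    by (auto simp: paths_within_def)
  moreover have "?W \<subseteq> ?L"
    by (auto simp: paths_within_def)
  ultimately show ?thesis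
    using card_paths_within[of P a b i j] card_lattice_paths[of a b i j]
    by (simp add: card_Diff_subset)
qed

text \<open>Phrased as leaving the open half-plane below the line, the form that
  \<open>card_paths_leaving\<close> counts. For \<open>c = 1\<close> these paths go strictly above
  the diagonal.\<close>

definition paths_above :: "int \<Rightarrow> int \<times> int \<Rightarrow> int \<times> int \<Rightarrow> (int \<times> int) list set" where
  "paths_above c p q = {ps \<in> lattice_paths p q. \<exists>x\<in>set ps. \<not> snd x < fst x + c}"

definition paths_below :: "int \<Rightarrow> int \<times> int \<Rightarrow> int \<times> int \<Rightarrow> (int \<times> int) list set" where
  "paths_below c p q = {ps \<in> lattice_paths p q. \<exists>x\<in>set ps. \<not> fst x < snd x + c}"

lemma card_paths_above:
  "card (paths_above (int c) (int m, int m) (int m + int s, int m + int s)) =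
    ((s + s) choose s) - path_count (\<lambda>i j. j < i + c) s s"
proof -
  have "(int m + int j < int m + int i + int c) = (j < i + c)" for i j
    by linarith
  then show ?thesis
    unfolding paths_above_def card_paths_leaving by simp
qed

text \<open>Reflection in the diagonal, in the form of \<open>path_count_swap\<close>, gives the
  same number as for \<open>paths_above\<close>.\<close>

lemma card_paths_below:
  "card (paths_below (int c) (int m, int m) (int m + int s, int m + int s)) =
    ((s + s) choose s) - path_count (\<lambda>i j. j < i + c) s s"
proof -
  have "(int m + int i < int m + int j + int c) = (i < j + c)" for i j
    by linarith
  then show ?thesis
    unfolding paths_below_def card_paths_leaving
    using path_count_swap[of "\<lambda>i j. j < i + c" s s] by simp
qed

text \<open>A path that starts on or below the line and gets to or beyond it must visit it, by
  \<open>path_visits_level\<close>.\<close>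

lemma mem_paths_above_iff:
  assumes "ps \<in> lattice_paths p q" "snd p \<le> fst p + c"
  shows "ps \<in> paths_above c p q \<longleftrightarrow> (\<exists>(x, y)\<in>set ps. y = x + c)"
proof
  assume "ps \<in> paths_above c p q"
  then obtain x where "x \<in> set ps" "c \<le> snd x - fst x"
    by (force simp: paths_above_def)
  then have "\<exists>z\<in>set ps. snd z - fst z = c"
    using assms by (intro path_visits_level[of _ "\<lambda>z. snd z - fst z"])
      (auto simp: lattice_paths_def unit_step_def)
  then show "\<exists>(x, y)\<in>set ps. y = x + c"
    by (auto simp: split_def algebra_simps)
qed (use assms in \<open>force simp: paths_above_def\<close>)

lemma mem_paths_below_iff:
  assumes "ps \<in> lattice_paths p q" "fst p \<le> snd p + c"
  shows "ps \<in> paths_below c p q \<longleftrightarrow> (\<exists>(x, y)\<in>set ps. x = y + c)"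
proof
  assume "ps \<in> paths_below c p q"
  then obtain x where "x \<in> set ps" "c \<le> fst x - snd x"
    by (force simp: paths_below_def)
  then have "\<exists>z\<in>set ps. fst z - snd z = c"
    using assms by (intro path_visits_level[of _ "\<lambda>z. fst z - snd z"])
      (auto simp: lattice_paths_def unit_step_def)
  then show "\<exists>(x, y)\<in>set ps. x = y + c"
    by (auto simp: split_def algebra_simps)
qed (use assms in \<open>force simp: paths_below_def\<close>)

text \<open>A point two above the diagonal has second coordinate at least \<open>a + 2\<close>, so a
  later point two below it has first coordinate at least \<open>a + 4\<close>, which leaves the
  square. The other order is symmetric.\<close>

lemma paths_above_below_disjoint:
  assumes "s \<le> 3"
  shows "paths_above 2 (a, a) (a + int s, a + int s) \<inter> paths_below 2 (a, a) (a + int s, a + int s) = {}"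
proof -
  have False if ps: "ps \<in> lattice_paths (a, a) (a + int s, a + int s)"
    and x: "x \<in> set ps" "\<not> snd x < fst x + 2" and y: "y \<in> set ps" "\<not> fst y < snd y + 2" for ps x y
  proof -
    have "dominated x y \<or> dominated y x"
      using ps x y by (intro path_comparable) (auto simp: lattice_paths_def)
    with path_between[OF ps x(1)] path_between[OF ps y(1)] x(2) y(2) assms show False
      by (auto simp: dominated_def)
  qed
  then show ?thesis
    unfolding paths_above_def paths_below_def by blast
qed

section \<open>Counting admissible paths\<close>

text \<open>The two halves lie in squares that share only the corner \<open>(m, m)\<close>. Hence
  \<open>seg1\<close> and \<open>seg2\<close> concern only \<open>h\<close>, while
  \<open>seg3\<close> and \<open>seg4\<close> concern only \<open>k\<close>, and the range
  conditions hold automatically there.\<close>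

lemma join_paths_intersects:
  assumes h: "h \<in> lattice_paths (0, 0) (int m, int m)"
    and k: "k \<in> lattice_paths (int m, int m) (int m + int s, int m + int s)"
    and "m > 0"
  shows "intersects (h @ tl k) (seg1 m) \<longleftrightarrow> h \<in> paths_above 1 (0, 0) (int m, int m)"
    and "intersects (h @ tl k) (seg2 m) \<longleftrightarrow> h \<in> paths_below 1 (0, 0) (int m, int m)"
    and "intersects (h @ tl k) (seg3 m s) \<longleftrightarrow>
      k \<in> paths_above 2 (int m, int m) (int m + int s, int m + int s)"
    and "intersects (h @ tl k) (seg4 m s) \<longleftrightarrow>
      k \<in> paths_below 2 (int m, int m) (int m + int s, int m + int s)"
proof -
  let ?c = "(int m, int m)"
  have "h @ tl k \<in> (\<lambda>(h, k). h @ tl k) `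
      (lattice_paths (0, 0) ?c \<times> lattice_paths ?c (int m + int s, int m + int s))"
    using h k by (intro image_eqI[of _ _ "(h, k)"]) simp_all
  then have path: "successively unit_step (h @ tl k)"
    unfolding lattice_paths_through[symmetric] by (simp add: lattice_paths_def)
  obtain ks where "k = ?c # ks"
    using k by (cases k) (auto simp: lattice_paths_def)
  moreover have "?c \<in> set h"
    using h last_in_set[of h] by (simp add: lattice_paths_def)
  ultimately have set_join: "set (h @ tl k) = set h \<union> set k"
    by auto
  have hb: "0 \<le> x \<and> 0 \<le> y \<and> x \<le> int m \<and> y \<le> int m" if "(x, y) \<in> set h" for x y
    using path_between[OF h that] by (simp add: dominated_def)
  have kb: "int m \<le> x \<and> int m \<le> y \<and> x \<le> int m + int s \<and> y \<le> int m + int s"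
    if "(x, y) \<in> set k" for x y
    using path_between[OF k that] by (simp add: dominated_def)
  show "intersects (h @ tl k) (seg1 m) \<longleftrightarrow> h \<in> paths_above 1 (0, 0) ?c"
  proof -
    \<comment> \<open>In \<open>h\<close>, \<open>y \<le> m\<close> forces \<open>x < m\<close>; in
      \<open>k\<close>, \<open>m \<le> x\<close>.\<close>
    have "(x, y) \<in> set h \<union> set k \<and> y = x + 1 \<and> (0 \<le> x \<and> x < int m \<or> m = 0 \<and> x = 0) \<longleftrightarrow>
        (x, y) \<in> set h \<and> y = x + 1" for x y
      using hb[of x y] kb[of x y] \<open>m > 0\<close> by auto
    moreover have "h \<in> paths_above 1 (0, 0) ?c \<longleftrightarrow>
        (\<exists>(x, y)\<in>set h. y = x + 1)"
      using h by (rule mem_paths_above_iff) simp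
    ultimately show ?thesis
      unfolding intersects_seg1_iff[OF path] set_join
      by (simp only: Bex_def split_paired_Ex case_prod_conv)
  qed
  show "intersects (h @ tl k) (seg2 m) \<longleftrightarrow> h \<in> paths_below 1 (0, 0) ?c"
  proof -
    have "(x, y) \<in> set h \<union> set k \<and> x = y + 1 \<and> (0 \<le> y \<and> y < int m \<or> m = 0 \<and> y = 0) \<longleftrightarrow>
        (x, y) \<in> set h \<and> x = y + 1" for x y
      using hb[of x y] kb[of x y] \<open>m > 0\<close> by auto
    moreover have "h \<in> paths_below 1 (0, 0) ?c \<longleftrightarrow>
        (\<exists>(x, y)\<in>set h. x = y + 1)"
      using h by (rule mem_paths_below_iff) simp
    ultimately show ?thesis
      unfolding intersects_seg2_iff[OF path] set_join
      by (simp only: Bex_def split_paired_Ex case_prod_conv)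
  qed
  show "intersects (h @ tl k) (seg3 m s) \<longleftrightarrow> k \<in> paths_above 2 ?c (int m + int s, int m + int s)"
  proof -
    \<comment> \<open>A point of \<open>h\<close> with \<open>m - 1 \<le> x\<close> would have
      \<open>y = x + 2 > m\<close>; in \<open>k\<close>, the bounds follow from
      \<open>m \<le> x\<close> and \<open>y \<le> m + s\<close>.\<close>
    have "(x, y) \<in> set h \<union> set k \<and> y = x + 2 \<and> int m - 1 \<le> x \<and> x \<le> int m + int s - 1 \<longleftrightarrow>
        (x, y) \<in> set k \<and> y = x + 2" for x y
      using hb[of x y] kb[of x y] by auto
    moreover have "k \<in> paths_above 2 ?c (int m + int s, int m + int s) \<longleftrightarrow>
        (\<exists>(x, y)\<in>set k. y = x + 2)"
      using k by (rule mem_paths_above_iff) simp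
    ultimately show ?thesis
      unfolding intersects_seg3_iff[OF path] set_join
      by (simp only: Bex_def split_paired_Ex case_prod_conv)
  qed
  show "intersects (h @ tl k) (seg4 m s) \<longleftrightarrow> k \<in> paths_below 2 ?c (int m + int s, int m + int s)"
  proof -
    have "(x, y) \<in> set h \<union> set k \<and> x = y + 2 \<and> int m - 1 \<le> y \<and> y \<le> int m + int s - 1 \<longleftrightarrow>
        (x, y) \<in> set k \<and> x = y + 2" for x y
      using hb[of x y] kb[of x y] by auto
    moreover have "k \<in> paths_below 2 ?c (int m + int s, int m + int s) \<longleftrightarrow>
        (\<exists>(x, y)\<in>set k. x = y + 2)"
      using k by (rule mem_paths_below_iff) simp
    ultimately show ?thesis
      unfolding intersects_seg4_iff[OF path] set_join
      by (simp only: Bex_def split_paired_Ex case_prod_conv)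
  qed
qed

lemma card_admissible_paths:
  assumes "s \<le> 3" "m > 0"
  defines "N \<equiv> ((2 * s) choose s) - path_count (\<lambda>i j. j < i + 2) s s"
    and "C \<equiv> path_count (\<lambda>i j. j \<le> i) m m"
  shows "card (admissible_paths m s) =
    ((2 * m) choose m) * ((2 * s) choose s) - 2 * ((((2 * m) choose m) - C) * N)"
proof -
  let ?o = "(0 :: int, 0 :: int)" and ?c = "(int m, int m)" and ?q = "(int m + int s, int m + int s)"
  let ?H = "lattice_paths ?o ?c" and ?K = "lattice_paths ?c ?q"
  let ?A = "paths_above 1 ?o ?c" and ?B = "paths_below 1 ?o ?c"
  let ?U = "paths_above 2 ?c ?q" and ?D = "paths_below 2 ?c ?q"
  \<comment> \<open>The pairs of halves whose join is forbidden.\<close>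
  let ?E = "?A \<times> ?D \<union> ?B \<times> ?U"
  have cards: "finite ?H" "card ?H = (2 * m) choose m" "finite ?K" "card ?K = (2 * s) choose s"
    using card_lattice_paths[of 0 0 m m] card_lattice_paths[of "int m" "int m" s s]
    by (simp_all add: mult_2)
  have AB: "card ?A = ((2 * m) choose m) - C" "card ?B = ((2 * m) choose m) - C"
    using card_paths_above[of 1 0 m] card_paths_below[of 1 0 m]
    by (simp_all add: C_def mult_2 less_Suc_eq_le)
  have UD: "card ?U = N" "card ?D = N"
    using card_paths_above[of 2 m s] card_paths_below[of 2 m s]
    by (simp_all add: N_def mult_2)
  have sub: "?A \<subseteq> ?H" "?B \<subseteq> ?H" "?U \<subseteq> ?K" "?D \<subseteq> ?K"
    by (auto simp: paths_above_def paths_below_def)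
  have fin: "finite ?A" "finite ?B" "finite ?U" "finite ?D"
    using sub cards by (auto intro: finite_subset)
  have "admissible_paths m s = {ps \<in> {ps \<in> lattice_paths ?o ?q. ?c \<in> set ps}.
      \<not> (intersects ps (seg1 m) \<and> intersects ps (seg4 m s)) \<and>
      \<not> (intersects ps (seg2 m) \<and> intersects ps (seg3 m s))}"
    by (auto simp: admissible_paths_def)
  also have "\<dots> = (\<lambda>(h, k). h @ tl k) ` (?H \<times> ?K - ?E)"
    unfolding lattice_paths_through using join_paths_intersects[OF _ _ \<open>m > 0\<close>, of _ _ s]
    by (auto simp: image_iff)
  finally have "card (admissible_paths m s) = card (?H \<times> ?K - ?E)"
    using card_image[OF inj_on_subset[OF inj_on_join_paths Diff_subset]] by (simp only:)
  also have "\<dots> = card (?H \<times> ?K) - card ?E"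
    using fin sub by (intro card_Diff_subset) auto
  \<comment> \<open>Disjointness comes from the second factors alone; a first half may go both above
    and below the diagonal.\<close>
  also have "card ?E = card (?A \<times> ?D) + card (?B \<times> ?U)"
    using fin paths_above_below_disjoint[OF \<open>s \<le> 3\<close>, of "int m"]
    by (intro card_Un_disjoint) auto
  finally show ?thesis
    by (simp add: card_cartesian_product cards AB UD mult_2)
qed

text \<open>Here \<open>seg1 0\<close> can be met only at \<open>(0, 1)\<close>, and within the
  square of side at most two \<open>seg4\<close> can be met only at \<open>(2, 0)\<close>. These
  points are incomparable, so no path visits both. The other pair is the mirror image.\<close>

lemma admissible_paths_0:
  assumes "s \<le> 2"
  shows "admissible_paths 0 s = lattice_paths (0, 0) (int s, int s)"
proof -
  have "(0, 0) \<in> set ps \<and>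
      \<not> (intersects ps (seg1 0) \<and> intersects ps (seg4 0 s)) \<and>
      \<not> (intersects ps (seg2 0) \<and> intersects ps (seg3 0 s))"
    if ps: "ps \<in> lattice_paths (0, 0) (int s, int s)" for ps
  proof (intro conjI)
    show "(0, 0) \<in> set ps"
      using ps by (metis (mono_tags, lifting) lattice_paths_def list.set_sel(1) mem_Collect_eq)
    have path: "successively unit_step ps"
      using ps by (simp add: lattice_paths_def)
    have b: "0 \<le> x \<and> 0 \<le> y \<and> x \<le> 2 \<and> y \<le> 2" if "(x, y) \<in> set ps" for x y
      using path_between[OF ps that] assms by (simp add: dominated_def)
    show "\<not> (intersects ps (seg1 0) \<and> intersects ps (seg4 0 s))"
      unfolding intersects_seg1_iff[OF path] intersects_seg4_iff[OF path]
      using path_comparable[OF path, of "(0, 1)"] b by (fastforce simp: dominated_def)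
    show "\<not> (intersects ps (seg2 0) \<and> intersects ps (seg3 0 s))"
      unfolding intersects_seg2_iff[OF path] intersects_seg3_iff[OF path]
      using path_comparable[OF path, of "(1, 0)"] b by (fastforce simp: dominated_def)
  qed
  then show ?thesis
    by (auto simp: admissible_paths_def)
qed

section \<open>Numerical values and the super Catalan number\<close>

text \<open>The recurrence is evaluated case by case. The values for \<open>s = 2\<close> and
  \<open>s = 3\<close> are \<open>(2 * s) choose (s - 2)\<close>, as the reflection principle
  predicts.\<close>

lemma path_count_strip:
  assumes "s \<in> {0, 1, 2, 3}"
  shows "((2 * s) choose s) - path_count (\<lambda>i j. j < i + 2) s s =
    (if s = 3 then 6 else if s = 2 then 1 else 0)"
proof -
  consider "s = 0" | "s = 1" | "s = 2" | "s = 3"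
    using assms by auto
  then show ?thesis
    by cases (simp_all add: numeral_eq_Suc)
qed

text \<open>The factor \<open>m + 1\<close> clears the denominator of the Catalan number;
  \<open>12\<close> and \<open>2\<close> are twice the values in
  \<open>path_count_strip\<close>.\<close>

lemma super_catalan_ratio:
  assumes "s \<in> {0, 1, 2, 3}"
  shows "real (m + 1) * super_catalan m (m + s) = real ((2 * m) choose m) *
    (2 ^ s * real (m + 1) + (if s = 3 then 12 else if s = 2 then 2 else 0))"
proof -
  have B: "real ((2 * m) choose m) = fact (2 * m) / (fact m * fact m)"
    by (simp add: binomial_fact mult_2)
  have f: "fact (2 * m) \<noteq> (0 :: real)" "fact m \<noteq> (0 :: real)"
    "real m + 1 \<noteq> 0" "real m + 2 \<noteq> 0" "real m + 3 \<noteq> 0"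
    "2 * real m + 1 \<noteq> 0" "2 * real m + 2 \<noteq> 0" "2 * real m + 3 \<noteq> 0"
    by auto
  have e: "fact (n + 1) = (real n + 1) * fact n" "fact (n + 2) = (real n + 2) * (real n + 1) * fact n"
    "fact (n + 3) = (real n + 3) * (real n + 2) * (real n + 1) * fact n" for n
    by (simp_all add: numeral_eq_Suc algebra_simps)
  consider "s = 0" | "s = 1" | "s = 2" | "s = 3"
    using assms by auto
  then show ?thesis
  proof cases
    case 1
    then show ?thesis
      by (simp add: super_catalan_def B flip: mult_2)
  next
    case 2
    \<comment> \<open>The arguments are written as repeated shifts by \<open>s\<close> so that
      \<open>e\<close> reduces all factorials to \<open>fact (2 * m)\<close> and
      \<open>fact m\<close>; likewise in the next two cases.\<close>
    have "2 * (m + s) = 2 * m + 1 + 1" "m + (m + s) = 2 * m + 1"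
      using 2 by auto
    then show ?thesis
      using f unfolding super_catalan_def B
      by (simp only: 2 e) (simp add: divide_simps; simp add: algebra_simps)
  next
    case 3
    have "2 * (m + s) = 2 * m + 2 + 2" "m + (m + s) = 2 * m + 2"
      using 3 by auto
    then show ?thesis
      using f unfolding super_catalan_def B
      by (simp only: 3 e) (simp add: divide_simps; simp add: algebra_simps)
  next
    case 4
    have "2 * (m + s) = 2 * m + 3 + 3" "m + (m + s) = 2 * m + 3"
      using 4 by auto
    then show ?thesis
      using f unfolding super_catalan_def B
      by (simp only: 4 e) (simp add: divide_simps; simp add: algebra_simps)
  qed
qed

theorem theorem3p1:
  fixes m s :: nat
  assumes "s \<in> {0, 1, 2, 3}"
    and "\<not> (m = 0 \<and> s = 3)"
  shows "super_catalan m (m + s) =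
      (fact (2 * m) * fact (2 * m + 2 * s)) / (fact m * fact (m + s) * fact (2 * m + s)) \<and>
    super_catalan m (m + s) = real (card (admissible_paths m s))"
proof
  show "super_catalan m (m + s) =
      (fact (2 * m) * fact (2 * m + 2 * s)) / (fact m * fact (m + s) * fact (2 * m + s))"
    by (simp add: super_catalan_def algebra_simps mult_2_right)
  show "super_catalan m (m + s) = real (card (admissible_paths m s))"
  proof (cases "m = 0")
    case True
    with assms have "card (admissible_paths m s) = (2 * s) choose s"
      using card_lattice_paths(2)[of 0 0 s s] by (auto simp: admissible_paths_0)
    then show ?thesis
      by (simp add: True super_catalan_def binomial_fact mult_2)
  next
    case False
    define B where "B = (2 * m) choose m"
    define C where "C = path_count (\<lambda>i j. j \<le> i) m m"
    define N :: nat where "N = (if s = 3 then 6 else if s = 2 then 1 else 0)"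
    have BC: "(m + 1) * C = B"
      unfolding B_def C_def by (rule path_count_catalan)
    then have "C \<le> B"
      by auto
    \<comment> \<open>Of all second halves, \<open>2 ^ s\<close> stay within distance one of the
      diagonal in the sense that the coordinates differ by at most one; \<open>N\<close> go further
      on each side.\<close>
    have T: "(2 * s) choose s = 2 ^ s + 2 * N"
      using assms(1) by (auto simp: N_def numeral_eq_Suc)
    have "card (admissible_paths m s) = B * (2 ^ s + 2 * N) - 2 * ((B - C) * N)"
      using card_admissible_paths[of s m] False assms(1) path_count_strip[OF assms(1)]
      by (auto simp: B_def C_def N_def T)
    \<comment> \<open>Lets the truncated subtraction cancel, leaving
      \<open>2 * (C * N)\<close>.\<close>
    moreover have "B * N = (B - C) * N + C * N"
      using \<open>C \<le> B\<close> by (simp flip: add_mult_distrib)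
    ultimately have "card (admissible_paths m s) = B * 2 ^ s + 2 * (C * N)"
      by (simp add: add_mult_distrib2)
    \<comment> \<open>Multiplying by \<open>m + 1\<close> allows \<open>BC\<close> to replace the
      Catalan number by \<open>B\<close>.\<close>
    then have "real (m + 1) * real (card (admissible_paths m s)) =
        real (m + 1) * real B * 2 ^ s + 2 * (real ((m + 1) * C) * real N)"
      by (simp add: algebra_simps)
    also have "\<dots> = real (m + 1) * super_catalan m (m + s)"
      unfolding BC super_catalan_ratio[OF assms(1)] B_def[symmetric]
      by (simp add: N_def algebra_simps)
    finally show ?thesis
      by simp
  qed
qed

end
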